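(* If $G$ is a $(2,1,g)$-graph whose underlying tree has height $m$, then $g\le (4+o(1))\log(\log^* m)$, where the $o(1)$ term tends to $0$ as $m\to\infty$. That is, for every $\varepsilon>0$ there is $M$ such that for all $m\ge M$ and all $g\in\mathbb{N}$, if there is a $(2,1,g)$-graph whose underlying tree has height $m$, then $g\le(4+\varepsilon)\log(\log^* m)$.
   Context: All logarithms are in base $2$, and $\log^* m$ is the iterated (base $2$) logarithm, i.e., the number of times $\log$ must be applied starting from $m$ to reach a value at most $1$. Graphs are finite and simple. The girth of a graph is the length of a shortest cycle. A complete $d$-ary tree of height $m$ is a rooted tree in which every internal (non-leaf) vertex has exactly $d$ children and every leaf is at distance $m$ from the root. An $r$-augmented tree is a graph consisting of a rooted tree (the underlying tree) plus, for each leaf of it, $r$ additional edges (augmenting edges) joining that leaf to $r$ distinct non-parent ancestors. A $(d,r,g)$-graph is a bipartite $r$-augmented complete $d$-ary tree having girth at least $g$. *)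

theory Defs
  imports Complex_Main "HOL-Library.Extended_Nat"
begin

text \<open>A graph is given by a vertex set \<open>V\<close> and a set \<open>E\<close> of unordered pairs of vertices.\<close>

definition simple_graph :: "'a set \<Rightarrow> 'a set set \<Rightarrow> bool" where
  "simple_graph V E \<longleftrightarrow> finite V \<and> (\<forall>e\<in>E. e \<subseteq> V \<and> card e = 2)"

definition bipartite :: "'a set \<Rightarrow> 'a set set \<Rightarrow> bool" where
  "bipartite V E \<longleftrightarrow>
     (\<exists>A B. A \<union> B = V \<and> A \<inter> B = {} \<and> (\<forall>e\<in>E. \<exists>a\<in>A. \<exists>b\<in>B. e = {a, b}))"

text \<open>A path or cycle is the list of its vertices without repetition; a cycle closes up from the
  last vertex of the list to the first, so its length is the length of the list.\<close>

definition path_between :: "'a set \<Rightarrow> 'a set set \<Rightarrow> 'a \<Rightarrow> 'a list \<Rightarrow> 'a \<Rightarrow> bool" where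
  "path_between V E u p v \<longleftrightarrow>
     p \<noteq> [] \<and> hd p = u \<and> last p = v \<and> set p \<subseteq> V \<and> distinct p \<and>
     (\<forall>i. Suc i < length p \<longrightarrow> {p ! i, p ! Suc i} \<in> E)"

definition is_cycle :: "'a set set \<Rightarrow> 'a list \<Rightarrow> bool" where
  "is_cycle E c \<longleftrightarrow>
     length c \<ge> 3 \<and> distinct c \<and>
     (\<forall>i < length c. {c ! i, c ! (Suc i mod length c)} \<in> E)"

text \<open>The girth of an acyclic graph is \<open>\<infinity>\<close>.\<close>

definition girth :: "'a set set \<Rightarrow> enat" where
  "girth E = (INF c\<in>{c. is_cycle E c}. enat (length c))"

definition connected_graph :: "'a set \<Rightarrow> 'a set set \<Rightarrow> bool" where
  "connected_graph V E \<longleftrightarrow> V \<noteq> {} \<and> (\<forall>u\<in>V. \<forall>v\<in>V. \<exists>p. path_between V E u p v)"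

text \<open>The number of edges of a shortest path; used only in connected graphs.\<close>

definition graph_dist :: "'a set \<Rightarrow> 'a set set \<Rightarrow> 'a \<Rightarrow> 'a \<Rightarrow> nat" where
  "graph_dist V E u v = (LEAST k. \<exists>p. path_between V E u p v \<and> length p = Suc k)"

definition rooted_tree :: "'a set \<Rightarrow> 'a set set \<Rightarrow> 'a \<Rightarrow> bool" where
  "rooted_tree V T \<rho> \<longleftrightarrow>
     simple_graph V T \<and> connected_graph V T \<and> (\<nexists>c. is_cycle T c) \<and> \<rho> \<in> V"

text \<open>Ancestors are proper: \<open>u\<close> is an ancestor of \<open>v\<close> if \<open>u \<noteq> v\<close> lies on the (unique) path of the
  tree from the root \<open>\<rho>\<close> to \<open>v\<close>.\<close>

definition ancestor :: "'a set \<Rightarrow> 'a set set \<Rightarrow> 'a \<Rightarrow> 'a \<Rightarrow> 'a \<Rightarrow> bool" where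
  "ancestor V T \<rho> u v \<longleftrightarrow> u \<noteq> v \<and> (\<exists>p. path_between V T \<rho> p v \<and> u \<in> set p)"

definition parent :: "'a set \<Rightarrow> 'a set set \<Rightarrow> 'a \<Rightarrow> 'a \<Rightarrow> 'a \<Rightarrow> bool" where
  "parent V T \<rho> u v \<longleftrightarrow> ancestor V T \<rho> u v \<and> {u, v} \<in> T"

definition children :: "'a set \<Rightarrow> 'a set set \<Rightarrow> 'a \<Rightarrow> 'a \<Rightarrow> 'a set" where
  "children V T \<rho> u = {v \<in> V. parent V T \<rho> u v}"

definition leaves :: "'a set \<Rightarrow> 'a set set \<Rightarrow> 'a \<Rightarrow> 'a set" where
  "leaves V T \<rho> = {v \<in> V. children V T \<rho> v = {}}"

definition complete_dary_tree ::
    "nat \<Rightarrow> nat \<Rightarrow> 'a set \<Rightarrow> 'a set set \<Rightarrow> 'a \<Rightarrow> bool" where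
  "complete_dary_tree d m V T \<rho> \<longleftrightarrow>
     rooted_tree V T \<rho> \<and>
     (\<forall>v \<in> V - leaves V T \<rho>. card (children V T \<rho> v) = d) \<and>
     (\<forall>v \<in> leaves V T \<rho>. graph_dist V T \<rho> v = m)"

text \<open>Here \<open>A v\<close> is the set of the \<open>r\<close> distinct other ends of the augmenting edges at the leaf \<open>v\<close>.
  They are new edges, since the only ancestor adjacent to \<open>v\<close> in the tree is its parent.\<close>

definition augmented_tree ::
    "nat \<Rightarrow> 'a set \<Rightarrow> 'a set set \<Rightarrow> 'a set set \<Rightarrow> 'a \<Rightarrow> bool" where
  "augmented_tree r V E T \<rho> \<longleftrightarrow>
     rooted_tree V T \<rho> \<and>
     (\<exists>A. (\<forall>v \<in> leaves V T \<rho>.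
              A v \<subseteq> {u \<in> V. ancestor V T \<rho> u v \<and> \<not> parent V T \<rho> u v} \<and> card (A v) = r) \<and>
          E = T \<union> {{v, u} | v u. v \<in> leaves V T \<rho> \<and> u \<in> A v})"

text \<open>\<open>(V, E)\<close> is a \<open>(d, r, g)\<close>-graph with underlying tree \<open>(V, T)\<close>, rooted at \<open>\<rho>\<close>, of height \<open>m\<close>.\<close>

definition drg_graph ::
    "nat \<Rightarrow> nat \<Rightarrow> nat \<Rightarrow> nat \<Rightarrow> 'a set \<Rightarrow> 'a set set \<Rightarrow> 'a set set \<Rightarrow> 'a \<Rightarrow> bool" where
  "drg_graph d r g m V E T \<rho> \<longleftrightarrow>
     augmented_tree r V E T \<rho> \<and> complete_dary_tree d m V T \<rho> \<and>
     bipartite V E \<and> enat g \<le> girth E"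

definition log_star :: "real \<Rightarrow> nat" where
  "log_star x = (LEAST k. (log 2 ^^ k) x \<le> 1)"

end

theory Submission
  imports Defs
begin

text \<open>
  Measure heights from the leaves upwards, so that the leaf \<open>v\<close> has its augmenting edge going to
  its ancestor at some height \<open>k v\<close>.  Choose \<open>h\<close> slightly larger than \<open>log (log\<^sup>* m)\<close>; the claim is
  that there is a cycle of length at most \<open>4 h + 4\<close>.

  Cut the heights up to \<open>m\<close> into scales: each height up to a bound linear in \<open>h\<close> forms a scale of its
  own, and above that bound one scale reaches from \<open>4 B\<close> to \<open>4 \<cdot> 2\<^sup>B\<close>, the next from \<open>4 \<cdot> 2\<^sup>B\<close> on, and
  so forth.  There are at most \<open>log\<^sup>* m + O(h)\<close> scales, which is fewer than \<open>2\<^sup>h\<close>.  Each vertex \<open>x\<close> of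
  height \<open>h\<close> has \<open>2\<^sup>h\<close> leaves below it, so two of them have augmenting edges reaching the same scale.
  No augmenting edge ends at height \<open>h\<close> or below, since it would close a branch of length at most \<open>h\<close>
  (\<open>short_cycle_one_leaf\<close>).  Hence if these two edges end at the same height, then they end at the same
  ancestor of \<open>x\<close>, and a cycle of length at most \<open>2 h + 2\<close> arises (\<open>short_cycle_common_end\<close>).  This
  settles the one-element scales.  Otherwise \<open>x\<close> is assigned a pair of distinct heights in a scale from \<open>4 B\<close> to \<open>4 \<cdot> 2\<^sup>B\<close>.

  Two vertices \<open>x \<noteq> x'\<close> of height \<open>h\<close> with a common ancestor at height \<open>4 B\<close> and with the same pair of
  heights would be joined twice, at two distinct common ancestors; going from leaf to leaf below \<open>x\<close>
  and below \<open>x'\<close> then closes a cycle of length at most \<open>4 h + 4\<close> (\<open>short_cycle_two_common_ends\<close>).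
  If there is no such cycle, then among the descendants of height \<open>h\<close> of a vertex at height \<open>4 B\<close>,
  of which there are \<open>2 ^ (4 B - h)\<close>, at most \<open>(4 \<cdot> 2\<^sup>B)\<^sup>2\<close> are assigned to this scale.  These fractions
  add up to less than \<open>1\<close>, although every vertex of height \<open>h\<close> is assigned to some scale: a contradiction (\<open>short_cycle_exists\<close>).

  Most of the remaining work translates a complete binary tree, given as a graph, into the tree of
  all words of length at most \<open>m\<close> over two letters (\<open>binary_coordinates\<close>), where a vertex is a word,
  its children prepend a letter, and the ancestor of a leaf at height \<open>k\<close> drops its first \<open>k\<close> letters.
\<close>

section \<open>Cycles and paths as lists\<close>

abbreviation walk :: "'a set set \<Rightarrow> 'a list \<Rightarrow> bool" where
  "walk E \<equiv> successively (\<lambda>x y. {x, y} \<in> E)"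

lemma is_cycleI:
  assumes "3 \<le> length c" "distinct c" "walk E c" "{last c, hd c} \<in> E"
  shows "is_cycle E c"
  unfolding is_cycle_def
proof (intro conjI allI impI)
  fix i assume i: "i < length c"
  show "{c ! i, c ! (Suc i mod length c)} \<in> E"
  proof (cases "Suc i < length c")
    case True
    then show ?thesis using assms(3) by (auto simp: successively_conv_nth)
  next
    case False
    with i have "Suc i = length c" by simp
    moreover from this have "c \<noteq> []" "i = length c - 1" by auto
    ultimately show ?thesis using assms(4) by (simp add: hd_conv_nth last_conv_nth)
  qed
qed (use assms in auto)

lemma walk_rev [simp]: "walk E (rev p) = walk E p"
  by (simp add: successively_rev insert_commute)

text \<open>Taking the preimages of edges under \<open>\<phi>\<close> as edges lets a cycle be sought among the coordinates of
  the vertices, where no graph is given to begin with, and be carried over afterwards.\<close>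

lemma is_cycle_map:
  assumes "is_cycle {e. \<phi> ` e \<in> E} c" "inj_on \<phi> (set c)"
  shows "is_cycle E (map \<phi> c)"
proof -
  have "\<phi> ` {c ! i, c ! (Suc i mod length c)} \<in> E" if "i < length c" for i
    using assms(1) that unfolding is_cycle_def by blast
  moreover have "Suc i mod length c < length c" if "i < length c" for i
    using that by (intro mod_less_divisor) auto
  ultimately show ?thesis
    using assms unfolding is_cycle_def by (auto simp: distinct_map)
qed

lemma walk_append_Cons: "walk E (xs @ y # ys) \<longleftrightarrow> walk E (xs @ [y]) \<and> walk E (y # ys)"
  by (auto simp: successively_append_iff successively_Cons)

lemma path_between_iff:
  "path_between V E u p v \<longleftrightarrow>
     p \<noteq> [] \<and> hd p = u \<and> last p = v \<and> set p \<subseteq> V \<and> distinct p \<and> walk E p"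
  unfolding path_between_def by (auto simp: successively_conv_nth)

text \<open>If two paths with the same ends part at \<open>u\<close>, then following the first until it meets the
  second again and returning along the second closes a cycle.\<close>

lemma acyclic_path_unique:
  assumes acyclic: "\<nexists>c. is_cycle E c"
  shows "path_between V E u p v \<Longrightarrow> path_between V E u q v \<Longrightarrow> p = q"
proof (induction p arbitrary: u q)
  case Nil
  then show ?case by (simp add: path_between_iff)
next
  case (Cons a p)
  then have a: "a = u" by (simp add: path_between_iff)
  from Cons.prems obtain q' where q: "q = u # q'"
    by (cases q) (auto simp: path_between_iff)
  show ?case
  proof (cases "p = [] \<or> q' = []")
    case True
    then show ?thesis using Cons.prems a q last_in_set
      by (auto simp: path_between_iff split: if_splits)
  next
    case False
    then have ne: "p \<noteq> []" "q' \<noteq> []" by auto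
    note P = Cons.prems(1)[unfolded path_between_iff a]
    note Q = Cons.prems(2)[unfolded path_between_iff q]
    from P ne have hp: "{u, hd p} \<in> E" "walk E p" "last p = v" by (auto simp: successively_Cons)
    from Q ne have hq: "{u, hd q'} \<in> E" "walk E q'" "last q' = v" by (auto simp: successively_Cons)
    show ?thesis
    proof (cases "hd p = hd q'")
      case True
      then have "path_between V E (hd p) p v" "path_between V E (hd p) q' v"
        using P Q ne hp hq by (auto simp: path_between_iff)
      then show ?thesis using Cons.IH a q by blast
    next
      case False
      have "\<exists>w\<in>set p. w \<in> set q'" using hp hq ne last_in_set by metis
      then obtain p1 w p2 where p: "p = p1 @ w # p2" and w: "w \<in> set q'"
        and p1: "\<forall>y\<in>set p1. y \<notin> set q'"
        using split_list_first_prop[of p "\<lambda>w. w \<in> set q'"] by blast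
      from w obtain q1 q2 where q': "q' = q1 @ w # q2" by (meson split_list)
      let ?c = "(u # p1) @ w # rev q1"
      have "is_cycle E ?c"
      proof (rule is_cycleI)
        show "3 \<le> length ?c" using False p q' by (cases p1; cases q1) auto
        show "distinct ?c" using P Q p q' p1 by auto
        have "walk E ((u # p1) @ w # p2)" "walk E (q1 @ w # q2)" using P hq p q' by auto
        then have "walk E ((u # p1) @ [w])" "walk E (rev (q1 @ [w]))"
          unfolding walk_rev walk_append_Cons[of E _ w p2] walk_append_Cons[of E _ w q2] by blast+
        then show "walk E ?c" unfolding walk_append_Cons[of E _ w "rev q1"] by simp
        have "{u, hd (q1 @ [w])} \<in> E" using hq q' by (cases q1) auto
        moreover have "last ?c = hd (q1 @ [w])" by (cases q1) auto
        ultimately show "{last ?c, hd ?c} \<in> E" by (simp add: insert_commute)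
      qed
      then show ?thesis using acyclic by blast
    qed
  qed
qed

section \<open>Root paths in rooted trees\<close>

definition root_path :: "'a set \<Rightarrow> 'a set set \<Rightarrow> 'a \<Rightarrow> 'a \<Rightarrow> 'a list" where
  "root_path V T \<rho> v = (THE p. path_between V T \<rho> p v)"

context
  fixes V :: "'a set" and T :: "'a set set" and \<rho> :: 'a
  assumes tree: "rooted_tree V T \<rho>"
begin

lemma root_path_eq: "path_between V T \<rho> p v \<Longrightarrow> root_path V T \<rho> v = p"
proof -
  have acyclic: "\<nexists>c. is_cycle T c" using tree by (simp add: rooted_tree_def)
  show "path_between V T \<rho> p v \<Longrightarrow> root_path V T \<rho> v = p"
    unfolding root_path_def by (intro the_equality acyclic_path_unique[OF acyclic])
qed

lemma path_between_root_path: "v \<in> V \<Longrightarrow> path_between V T \<rho> (root_path V T \<rho> v) v"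
proof -
  assume "v \<in> V"
  then obtain p where "path_between V T \<rho> p v"
    using tree unfolding rooted_tree_def connected_graph_def by blast
  then show ?thesis using root_path_eq by simp
qed

lemma root_path_root: "root_path V T \<rho> \<rho> = [\<rho>]"
proof -
  have "\<rho> \<in> V" using tree by (simp add: rooted_tree_def)
  then show ?thesis by (intro root_path_eq) (simp add: path_between_iff)
qed

lemma ancestor_iff: "v \<in> V \<Longrightarrow> ancestor V T \<rho> u v \<longleftrightarrow> u \<noteq> v \<and> u \<in> set (root_path V T \<rho> v)"
  unfolding ancestor_def using path_between_root_path root_path_eq by auto

text \<open>The root path of \<open>v\<close> visits \<open>u\<close>, and its part up to \<open>u\<close> followed by the edge to \<open>v\<close> is again a path
  from the root to \<open>v\<close>; as there is only one, nothing lies between \<open>u\<close> and \<open>v\<close>.\<close>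

lemma root_path_child:
  assumes "v \<in> children V T \<rho> u"
  shows "root_path V T \<rho> v = root_path V T \<rho> u @ [v]"
proof -
  from assms have v: "v \<in> V" and uv: "u \<noteq> v" "{u, v} \<in> T" and u: "u \<in> set (root_path V T \<rho> v)"
    by (auto simp: children_def parent_def ancestor_iff)
  obtain xs ys where split: "root_path V T \<rho> v = xs @ u # ys" using u by (meson split_list)
  note p = path_between_root_path[OF v, unfolded split path_between_iff]
  have w: "walk T (xs @ [u])" using p walk_append_Cons[of T xs u ys] by blast
  then have "path_between V T \<rho> (xs @ [u]) u" using p by (auto simp: path_between_iff hd_append)
  then have ru: "root_path V T \<rho> u = xs @ [u]" by (rule root_path_eq)
  have "ys \<noteq> []" "last ys = v" using p uv by (auto split: if_splits)
  then have "v \<in> set ys" by auto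
  moreover have "walk T (xs @ [u, v])" using w uv walk_append_Cons[of T xs u "[v]"] by simp
  ultimately have "path_between V T \<rho> (xs @ [u, v]) v"
    using p uv v by (auto simp: path_between_iff hd_append)
  then show ?thesis using root_path_eq ru by simp
qed

lemma graph_dist_root: 
  assumes "v \<in> V" 
  shows "graph_dist V T \<rho> v = length (root_path V T \<rho> v) - 1"
  unfolding graph_dist_def
proof (rule Least_equality)
  have "root_path V T \<rho> v \<noteq> []"
    using path_between_root_path[OF assms] by (simp add: path_between_iff)
  then show "\<exists>p. path_between V T \<rho> p v \<and> length p = Suc (length (root_path V T \<rho> v) - 1)"
    using path_between_root_path[OF assms] by auto
qed (use root_path_eq in auto)

text \<open>A longest root path through \<open>u\<close> ends in a leaf, because a child of its end would prolong it.\<close>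

lemma leaf_below:
  assumes "u \<in> V"
  obtains v ys where "v \<in> leaves V T \<rho>" "root_path V T \<rho> v = root_path V T \<rho> u @ ys"
proof -
  let ?r = "root_path V T \<rho>"
  let ?D = "{v \<in> V. \<exists>ys. ?r v = ?r u @ ys}"
  have "finite V" using tree by (simp add: rooted_tree_def simple_graph_def)
  then have "finite ?D" "?D \<noteq> {}" using assms by auto
  then have "Max ((\<lambda>v. length (?r v)) ` ?D) \<in> (\<lambda>v. length (?r v)) ` ?D" by (intro Max_in) auto
  then obtain v where v: "v \<in> ?D" and v_max: "length (?r v) = Max ((\<lambda>v. length (?r v)) ` ?D)"
    by (metis (no_types, lifting) imageE)
  have max: "length (?r w) \<le> length (?r v)" if "w \<in> ?D" for w
    unfolding v_max using \<open>finite ?D\<close> that by (intro Max_ge) auto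
  have "v \<in> leaves V T \<rho>"
  proof (rule ccontr)
    assume "v \<notin> leaves V T \<rho>"
    then obtain w where w: "w \<in> children V T \<rho> v" using v by (auto simp: leaves_def)
    then have "w \<in> V" "?r w = ?r v @ [w]" using root_path_child by (auto simp: children_def)
    then have "w \<in> ?D" "length (?r w) > length (?r v)" using v by auto
    then show False using max[of w] by linarith
  qed
  then show thesis using v that by blast
qed

end

section \<open>Words as coordinates of a complete binary tree\<close>

text \<open>Walking down from the root, the letters of a word (read from its end) select children.  A vertex
  at depth less than \<open>m\<close> is never a leaf because leaves have depth \<open>m\<close>, so the walk does not get stuck.
  A vertex at depth \<open>m\<close> is a leaf because the leaf below it has depth \<open>m\<close> too.  Root paths determine
  words, which gives injectivity.\<close>

lemma binary_coordinates:
  assumes compl: "complete_dary_tree 2 m V T \<rho>"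
  obtains \<phi> :: "bool list \<Rightarrow> 'a" where
    "inj_on \<phi> {bs. length bs \<le> m}"
    "\<And>bs b. length bs < m \<Longrightarrow> {\<phi> bs, \<phi> (b # bs)} \<in> T"
    "\<And>bs. length bs = m \<Longrightarrow> \<phi> bs \<in> leaves V T \<rho>"
    "\<And>bs u. length bs \<le> m \<Longrightarrow> ancestor V T \<rho> u (\<phi> bs) \<Longrightarrow>
       \<exists>k. 0 < k \<and> k \<le> length bs \<and> u = \<phi> (drop k bs)"
    "\<And>bs b. length bs < m \<Longrightarrow> parent V T \<rho> (\<phi> bs) (\<phi> (b # bs))"
proof -
  let ?r = "root_path V T \<rho>"
  have tree: "rooted_tree V T \<rho>"
    and inner: "\<And>v. v \<in> V \<Longrightarrow> v \<notin> leaves V T \<rho> \<Longrightarrow> card (children V T \<rho> v) = 2"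
    and leaf: "\<And>v. v \<in> leaves V T \<rho> \<Longrightarrow> length (?r v) - 1 = m"
    using compl graph_dist_root by (fastforce simp: complete_dary_tree_def leaves_def)+
  have "\<exists>f :: bool \<Rightarrow> 'a. v \<in> V \<longrightarrow> v \<notin> leaves V T \<rho> \<longrightarrow> inj f \<and> range f \<subseteq> children V T \<rho> v" for v
  proof (cases "v \<in> V \<and> v \<notin> leaves V T \<rho>")
    case True
    then obtain x y where "children V T \<rho> v = {x, y}" "x \<noteq> y"
      using inner[of v] unfolding card_2_iff by blast
    then show ?thesis by (intro exI[of _ "\<lambda>b. if b then x else y"]) (auto simp: inj_def)
  qed auto
  then obtain f :: "'a \<Rightarrow> bool \<Rightarrow> 'a" where
    f: "\<And>v. v \<in> V \<Longrightarrow> v \<notin> leaves V T \<rho> \<Longrightarrow> inj (f v) \<and> range (f v) \<subseteq> children V T \<rho> v"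
    by metis
  define \<phi> where "\<phi> bs = foldr (\<lambda>b v. f v b) bs \<rho>" for bs
  have \<phi>_simps: "\<phi> [] = \<rho>" "\<And>b bs. \<phi> (b # bs) = f (\<phi> bs) b" by (simp_all add: \<phi>_def)

  have main: "\<phi> bs \<in> V \<and> length (?r (\<phi> bs)) = Suc (length bs) \<and>
      set (?r (\<phi> bs)) = (\<lambda>k. \<phi> (drop k bs)) ` {..length bs}" if "length bs \<le> m" for bs
    using that
  proof (induction bs)
    case Nil
    then show ?case using tree root_path_root[OF tree] by (simp add: \<phi>_simps rooted_tree_def)
  next
    case (Cons b bs)
    then have IH: "\<phi> bs \<in> V" "length (?r (\<phi> bs)) = Suc (length bs)"
      "set (?r (\<phi> bs)) = (\<lambda>k. \<phi> (drop k bs)) ` {..length bs}" by auto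
    have "\<phi> bs \<notin> leaves V T \<rho>" using leaf IH(2) Cons.prems by force
    then have ch: "\<phi> (b # bs) \<in> children V T \<rho> (\<phi> bs)" using f IH(1) by (auto simp: \<phi>_simps)
    have "(\<lambda>k. \<phi> (drop k (b # bs))) ` {..Suc (length bs)} =
        insert (\<phi> (b # bs)) ((\<lambda>k. \<phi> (drop k bs)) ` {..length bs})"
      by (simp add: atMost_Suc_eq_insert_0 image_image)
    then show ?case using IH ch root_path_child[OF tree ch] by (auto simp: children_def)
  qed
  have in_V: "\<phi> bs \<in> V" and len: "length (?r (\<phi> bs)) = Suc (length bs)"
    and set_r: "set (?r (\<phi> bs)) = (\<lambda>k. \<phi> (drop k bs)) ` {..length bs}"
    if "length bs \<le> m" for bs
    using main[OF that] by blast+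
  have inner_word: "\<phi> bs \<notin> leaves V T \<rho>" if "length bs < m" for bs
    using that len[of bs] leaf[of "\<phi> bs"] by auto
  have inj_f: "inj (f (\<phi> bs))" and child: "\<phi> (b # bs) \<in> children V T \<rho> (\<phi> bs)"
    if "length bs < m" for b bs
  proof -
    have "\<phi> bs \<in> V" using in_V[of bs] that by simp
    then have *: "inj (f (\<phi> bs)) \<and> range (f (\<phi> bs)) \<subseteq> children V T \<rho> (\<phi> bs)"
      using f inner_word[OF that] by blast
    then show "inj (f (\<phi> bs))" by blast
    show "\<phi> (b # bs) \<in> children V T \<rho> (\<phi> bs)"
      unfolding \<phi>_simps using conjunct2[OF *] rangeI by (rule subsetD)
  qed

  have same_length: "length bs = length cs" if "length bs \<le> m" "length cs \<le> m" "\<phi> bs = \<phi> cs" for bs cs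
    using len[OF that(1)] len[OF that(2)] unfolding that(3) by linarith
  have inj: "length bs \<le> m \<Longrightarrow> length cs \<le> m \<Longrightarrow> \<phi> bs = \<phi> cs \<Longrightarrow> bs = cs" for bs cs
  proof (induction bs arbitrary: cs)
    case Nil
    have "length ([] :: bool list) = length cs" by (rule same_length[OF Nil])
    then show ?case by simp
  next
    case (Cons b bs)
    have "length (b # bs) = length cs" by (rule same_length[OF Cons.prems])
    then obtain c cs' where cs: "cs = c # cs'" by (cases cs) auto
    then have lt: "length bs < m" "length cs' < m" using Cons.prems(1,2) by simp_all
    have "?r (\<phi> (b # bs)) = ?r (\<phi> (c # cs'))" using Cons.prems(3) cs by argo
    then have eq: "?r (\<phi> bs) = ?r (\<phi> cs')"
      unfolding root_path_child[OF tree child[OF lt(1)]] root_path_child[OF tree child[OF lt(2)]]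
      by blast
    have "last (?r (\<phi> bs)) = \<phi> bs" "last (?r (\<phi> cs')) = \<phi> cs'"
      using path_between_root_path[OF tree in_V, of bs] path_between_root_path[OF tree in_V, of cs'] lt
      unfolding path_between_iff by simp_all
    then have "\<phi> bs = \<phi> cs'" using eq by argo
    then have "bs = cs'" using Cons.IH[of cs'] lt by simp
    moreover from this have "f (\<phi> bs) b = f (\<phi> bs) c" using Cons.prems(3) cs by (simp add: \<phi>_simps)
    then have "b = c" by (rule injD[OF inj_f[OF lt(1)]])
    ultimately show ?case using cs by simp
  qed

  show thesis
  proof
    show "inj_on \<phi> {bs. length bs \<le> m}" using inj by (auto simp: inj_on_def)
    show "parent V T \<rho> (\<phi> bs) (\<phi> (b # bs))" if "length bs < m" for bs b
      using child[OF that] by (simp add: children_def)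
    show "{\<phi> bs, \<phi> (b # bs)} \<in> T" if "length bs < m" for bs b
      using child[OF that] by (simp add: children_def parent_def)
    show "\<phi> bs \<in> leaves V T \<rho>" if bs: "length bs = m" for bs
    proof -
      obtain v ys where v: "v \<in> leaves V T \<rho>" "?r v = ?r (\<phi> bs) @ ys"
        using leaf_below[OF tree in_V[OF eq_imp_le[OF bs]]] by blast
      then have "ys = []" using leaf[OF v(1)] len[of bs] bs by simp
      then have "?r v = ?r (\<phi> bs)" using v(2) by simp
      moreover have "last (?r w) = w" if "w \<in> V" for w
        using path_between_root_path[OF tree that] by (simp add: path_between_iff)
      moreover have "v \<in> V" "\<phi> bs \<in> V" using v(1) in_V[of bs] bs by (auto simp: leaves_def)
      ultimately have "v = \<phi> bs" by metis
      then show ?thesis using v by simp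
    qed
    show "\<exists>k. 0 < k \<and> k \<le> length bs \<and> u = \<phi> (drop k bs)"
      if bs: "length bs \<le> m" "ancestor V T \<rho> u (\<phi> bs)" for bs u
    proof -
      have "u \<noteq> \<phi> bs" "u \<in> set (?r (\<phi> bs))"
        using bs(2) unfolding ancestor_iff[OF tree in_V[OF bs(1)]] by blast+
      then obtain k where "k \<le> length bs" "u = \<phi> (drop k bs)"
        unfolding set_r[OF bs(1)] by auto
      with \<open>u \<noteq> \<phi> bs\<close> show ?thesis by (intro exI[of _ k]) (cases k; simp)
    qed
  qed
qed

section \<open>Short cycles through augmenting edges\<close>

text \<open>From here on the vertices are words, and \<open>E\<close> is only required to contain the tree edges between
  words of length at most \<open>m\<close>.  It may contain junk on longer words, which is why a short cycle
  has to stay within the tree.\<close>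

definition short_cycle :: "bool list set set \<Rightarrow> nat \<Rightarrow> nat \<Rightarrow> bool" where
  "short_cycle E m n \<longleftrightarrow> (\<exists>c. is_cycle E c \<and> length c \<le> n \<and> (\<forall>x\<in>set c. length x \<le> m))"

lemma short_cycle_mono: "short_cycle E m n \<Longrightarrow> n \<le> n' \<Longrightarrow> short_cycle E m n'"
  unfolding short_cycle_def by (meson order_trans)

context
  fixes E :: "bool list set set" and m :: nat
  assumes tree_edge: "\<And>bs b. length bs < m \<Longrightarrow> {bs, b # bs} \<in> E"
begin

text \<open>Two leaves of the subtree of height \<open>n\<close> below \<open>x\<close> are joined by a path inside this subtree.  The
  position of its vertices is recorded because paths from different subtrees get combined.\<close>

lemma walk_below:
  assumes "length u = n" "length u' = n" "n + length x \<le> m"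
  shows "\<exists>c. c \<noteq> [] \<and> hd c = u @ x \<and> last c = u' @ x \<and> distinct c \<and> walk E c \<and>
    length c \<le> 2 * n + 1 \<and> (\<forall>y\<in>set c. \<exists>z. y = z @ x \<and> length z \<le> n)"
  using assms
proof (induction n arbitrary: u u')
  case 0
  then show ?case by (intro exI[of _ "[x]"]) simp
next
  case (Suc n w w')
  obtain b u b' u' where w: "w = b # u" "w' = b' # u'" and len: "length u = n" "length u' = n"
    using Suc.prems by (metis length_Suc_conv)
  have "n + length x \<le> m" using Suc.prems by simp
  from Suc.IH[OF len this] obtain c
    where c: "c \<noteq> []" "hd c = u @ x" "last c = u' @ x" "distinct c" "walk E c"
      "length c \<le> 2 * n + 1" and below: "\<forall>y\<in>set c. \<exists>z. y = z @ x \<and> length z \<le> n"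
    by blast
  show ?case
  proof (cases "w = w'")
    case True
    have "\<exists>z. w @ x = z @ x \<and> length z \<le> Suc n" using Suc.prems by auto
    then show ?thesis using True by (intro exI[of _ "[w @ x]"]) simp
  next
    case False
    \<comment> \<open>This extension also covers \<open>u = u'\<close>, where \<open>c\<close> joins the common parent to itself.\<close>
    let ?c = "(w @ x) # c @ [w' @ x]"
    have new: "w @ x \<notin> set c" "w' @ x \<notin> set c"
      using below Suc.prems by force+
    have "{w @ x, u @ x} \<in> E" "{u' @ x, w' @ x} \<in> E"
      using tree_edge[of "u @ x" b] tree_edge[of "u' @ x" b'] Suc.prems w
      by (simp_all add: insert_commute)
    then have "walk E ?c" using c by (simp add: successively_append_iff successively_Cons)
    moreover have "distinct ?c" using c new False by simp
    moreover have "\<exists>z. y = z @ x \<and> length z \<le> Suc n" if y: "y \<in> set ?c" for y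
    proof -
      consider "y = w @ x" | "y = w' @ x" | "y \<in> set c" using y by auto
      then show ?thesis
      proof cases
        case 3
        then show ?thesis using below by (meson le_SucI)
      qed (use Suc.prems in auto)
    qed
    moreover have "length ?c \<le> 2 * Suc n + 1" using c(6) by simp
    moreover have "?c \<noteq> []" "hd ?c = w @ x" "last ?c = w' @ x" by simp_all
    ultimately show ?thesis by blast
  qed
qed

text \<open>An augmenting edge from \<open>v\<close> to height \<open>k\<close> closes the branch between its ends to a cycle.\<close>

lemma short_cycle_one_leaf:
  assumes "length v = m" "2 \<le> k" "k \<le> m" "{v, drop k v} \<in> E"
  shows "short_cycle E m (Suc k)"
proof -
  let ?c = "map (\<lambda>i. drop i v) [0..<Suc k]"
  have "walk E ?c"
    unfolding successively_conv_nth
  proof (intro allI impI)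
    fix i assume "Suc i < length ?c"
    then have "i < length v" and "Suc i < Suc k" using assms by auto
    moreover have "drop i v = v ! i # drop (Suc i) v"
      using \<open>i < length v\<close> by (simp add: Cons_nth_drop_Suc)
    ultimately show "{?c ! i, ?c ! Suc i} \<in> E"
      using tree_edge[of "drop (Suc i) v" "v ! i"] assms(1)
      by (simp add: insert_commute del: upt_Suc)
  qed
  moreover have "inj_on (\<lambda>i. drop i v) {0..<Suc k}"
  proof (rule inj_onI)
    fix i j assume "i \<in> {0..<Suc k}" "j \<in> {0..<Suc k}" "drop i v = drop j v"
    moreover from this have "length v - i = length v - j" by (metis length_drop)
    ultimately show "i = j" using assms by auto
  qed
  then have "distinct ?c" by (simp add: distinct_map del: upt_Suc)
  moreover have "last ?c = drop k v" "hd ?c = v" by (simp, simp add: upt_conv_Cons del: upt_Suc)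
  ultimately have "is_cycle E ?c"
    using assms by (intro is_cycleI) (auto simp: insert_commute)
  then show ?thesis unfolding short_cycle_def using assms(1) by (intro exI[of _ ?c]) auto
qed

text \<open>Two leaves below \<open>x\<close> whose augmenting edges both end at \<open>a\<close>.  The bound on the length of \<open>a\<close> puts \<open>a\<close>
  above \<open>x\<close>, off the path between the two leaves.\<close>

lemma short_cycle_common_end:
  assumes len: "length u = h" "length u' = h" "h + length x = m"
    and "u \<noteq> u'" "length a < length x" "{u @ x, a} \<in> E" "{u' @ x, a} \<in> E"
  shows "short_cycle E m (2 * h + 2)"
proof -
  obtain c where c: "c \<noteq> []" "hd c = u @ x" "last c = u' @ x" "distinct c" "walk E c"
    "length c \<le> 2 * h + 1" and below: "\<forall>y\<in>set c. \<exists>z. y = z @ x \<and> length z \<le> h"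
    using walk_below[OF len(1,2) eq_imp_le[OF len(3)]] by blast
  have "hd c \<noteq> last c" using c \<open>u \<noteq> u'\<close> by simp
  then have "2 \<le> length c" using c(1) by (cases c; cases "tl c") auto
  moreover have "a \<notin> set c" using below \<open>length a < length x\<close> by fastforce
  ultimately have "is_cycle E (c @ [a])"
    using c assms by (intro is_cycleI) (auto simp: successively_append_iff insert_commute)
  then show ?thesis unfolding short_cycle_def using c(6) below assms
    by (intro exI[of _ "c @ [a]"]) fastforce
qed

text \<open>The cycle runs from \<open>u\<close> to \<open>v\<close> below \<open>x\<close>, up to \<open>b\<close>, down to \<open>v'\<close>, on to \<open>u'\<close> below \<open>x'\<close>, and back through
  \<open>a\<close>.  The subtrees below \<open>x\<close> and \<open>x'\<close> are disjoint since these vertices have the same height.\<close>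

lemma short_cycle_two_common_ends:
  assumes len: "length u = h" "length v = h" "length u' = h" "length v' = h"
      "h + length x = m" "length x' = length x"
    and "x \<noteq> x'" "a \<noteq> b" "length a < length x" "length b < length x"
    and "{u @ x, a} \<in> E" "{u' @ x', a} \<in> E" "{v @ x, b} \<in> E" "{v' @ x', b} \<in> E"
  shows "short_cycle E m (4 * h + 4)"
proof -
  have le: "h + length x \<le> m" "h + length x' \<le> m" using len(5,6) by simp_all
  obtain c where c: "c \<noteq> []" "hd c = u @ x" "last c = v @ x" "distinct c" "walk E c"
    "length c \<le> 2 * h + 1" and below: "\<forall>y\<in>set c. \<exists>z. y = z @ x \<and> length z \<le> h"
    using walk_below[OF len(1,2) le(1)] by blast
  obtain c' where c': "c' \<noteq> []" "hd c' = v' @ x'" "last c' = u' @ x'" "distinct c'" "walk E c'"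
    "length c' \<le> 2 * h + 1" and below': "\<forall>y\<in>set c'. \<exists>z. y = z @ x' \<and> length z \<le> h"
    using walk_below[OF len(4,3) le(2)] by blast
  let ?c = "c @ b # c' @ [a]"
  have disjoint: "set c \<inter> set c' = {}"
  proof (rule ccontr)
    assume "set c \<inter> set c' \<noteq> {}"
    then obtain y where y: "y \<in> set c" "y \<in> set c'" by auto
    obtain z z' where z: "y = z @ x" "y = z' @ x'" using bspec[OF below y(1)] bspec[OF below' y(2)] by blast
    then have "z @ x = z' @ x'" by simp
    then have "x = x'" using len(6) append_eq_append_conv by metis
    then show False using \<open>x \<noteq> x'\<close> by simp
  qed
  have long: "length x \<le> length y \<and> length y \<le> m" if y: "y \<in> set c \<union> set c'" for y
  proof -
    obtain z where z: "y = z @ x \<or> y = z @ x'" "length z \<le> h"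
      using y bspec[OF below, of y] bspec[OF below', of y] by blast
    have "length y = length z + length x" using z(1) len(6) by (elim disjE) simp_all
    then show ?thesis using z(2) len(5) by simp
  qed
  have "a \<notin> set c \<union> set c'" "b \<notin> set c \<union> set c'"
    using long[of a] long[of b] assms(9,10) by linarith+
  then have "distinct ?c" using c(4) c'(4) disjoint \<open>a \<noteq> b\<close> by auto
  moreover have "walk E ?c"
    using c(1,3,5) c'(1,2,3,5) assms(12,13,14)
    by (simp add: successively_append_iff successively_Cons insert_commute)
  moreover have "3 \<le> length ?c" using c(1) c'(1) by (cases c; cases c') auto
  moreover have "{last ?c, hd ?c} \<in> E" using c(1,2) assms(11) by (simp add: insert_commute)
  ultimately have "is_cycle E ?c" by (intro is_cycleI)
  moreover have "length y \<le> m" if y: "y \<in> set ?c" for y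
  proof -
    consider "y \<in> set c \<union> set c'" | "y = a" | "y = b" using y by auto
    then show ?thesis using long[of y] le(1) assms(9,10) by cases auto
  qed
  moreover have "length ?c \<le> 4 * h + 4" using c(6) c'(6) by simp
  ultimately show ?thesis unfolding short_cycle_def by blast
qed

end

section \<open>Scales of heights\<close>

primrec tower :: "nat \<Rightarrow> nat \<Rightarrow> nat" where
  "tower b 0 = b"
| "tower b (Suc i) = 2 ^ tower b i"

lemma tower_mono: "i \<le> j \<Longrightarrow> tower b i \<le> tower b j"
  by (rule lift_Suc_mono_le[of "tower b"]) (simp_all add: less_imp_le)

lemma le_tower_base: "b \<le> tower b i"
  using tower_mono[of 0 i b] by simp

lemma le_tower_index: "i \<le> tower b i"
proof (induction i)
  case (Suc i)
  then have "i < 2 ^ tower b i" using less_exp[of "tower b i"] by linarith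
  then show ?case by (simp add: Suc_le_eq)
qed simp

text \<open>The scale reached by an edge that ends at height \<open>k\<close>.  Heights up to \<open>4 b\<close> are their own scales;
  the \<open>i\<close>-th scale above contains the heights from \<open>4 B\<close> to \<open>4 \<cdot> 2\<^sup>B\<close> for \<open>B = tower b i\<close>.  The factor
  \<open>4\<close> is there so that a vertex of height \<open>4 B\<close> has far more than \<open>(4 \<cdot> 2\<^sup>B)\<^sup>2\<close> leaves below it,
  that is, more than there are pairs of heights in the scale.\<close>

definition scale :: "nat \<Rightarrow> nat \<Rightarrow> nat" where
  "scale b k = (if k \<le> 4 * b then k else 4 * b + 1 + (LEAST i. k \<le> 4 * tower b (Suc i)))"

lemma scale_large:
  assumes "4 * b < k" "k \<le> 4 * tower b L"
  obtains i where "scale b k = 4 * b + 1 + i" "i < L" "4 * tower b i < k" "k \<le> 4 * tower b (Suc i)"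
proof -
  let ?P = "\<lambda>i. k \<le> 4 * tower b (Suc i)"
  define i where "i = (LEAST i. ?P i)"
  from assms obtain l where l: "L = Suc l" "?P l" by (cases L) auto
  have "?P i" "i \<le> l" unfolding i_def using l(2) by (auto intro: LeastI Least_le)
  moreover have "4 * tower b i < k"
  proof (cases i)
    case 0
    then show ?thesis using assms by simp
  next
    case (Suc j)
    then have "\<not> ?P j" unfolding i_def using not_less_Least[of j ?P] by simp
    then show ?thesis using Suc by simp
  qed
  moreover have "scale b k = 4 * b + 1 + i" unfolding scale_def i_def using assms by simp
  ultimately show thesis using that l(1) by simp
qed

lemma scale_less:
  assumes "k \<le> 4 * tower b L"
  shows "scale b k < 4 * b + 1 + L"
proof (cases "k \<le> 4 * b")
  case True
  then show ?thesis by (simp add: scale_def)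
next
  case False
  then obtain i where "scale b k = 4 * b + 1 + i" "i < L"
    using scale_large assms by (metis not_less)
  then show ?thesis by simp
qed

lemma scale_small: "scale b k = scale b k' \<Longrightarrow> k \<le> 4 * b \<Longrightarrow> k = k'"
  by (auto simp: scale_def split: if_splits)

section \<open>Counting\<close>

lemma card_words: "card {x :: bool list. length x = n} = 2 ^ n" "finite {x :: bool list. length x = n}"
  using card_lists_length_eq[of "UNIV :: bool set" n] finite_lists_length_eq[of "UNIV :: bool set" n]
  by simp_all

text \<open>The counting argument.  The tower starts at \<open>h + 2\<close>, so that for \<open>B \<ge> h + 2\<close> the vertices of height
  \<open>h\<close> assigned to one large scale make up a fraction of at most
  \<open>(4 \<cdot> 2\<^sup>B)\<^sup>2 / 2 ^ (4 B - h) \<le> 2 ^ (- h)\<close>.  Every vertex of height \<open>h\<close> is assigned to one of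
  the \<open>L\<close> large scales, and \<open>L < 2\<^sup>h\<close>.  The number \<open>4 h + 9\<close> is that of the one-element scales.\<close>

lemma short_cycle_exists:
  fixes E :: "bool list set set" and k :: "bool list \<Rightarrow> nat"
  assumes tree_edge: "\<And>bs b. length bs < m \<Longrightarrow> {bs, b # bs} \<in> E"
    and aug: "\<And>v. length v = m \<Longrightarrow> 2 \<le> k v \<and> k v \<le> m \<and> {v, drop (k v) v} \<in> E"
    and height: "m \<le> 4 * tower (h + 2) L"
    and few_scales: "4 * h + 9 + L < 2 ^ h"
  shows "short_cycle E m (4 * h + 4)"
proof (rule ccontr)
  assume no_cycle: "\<not> short_cycle E m (4 * h + 4)"
  have far: "h < k v" if "length v = m" for v
  proof (rule ccontr)
    assume "\<not> h < k v"
    then have "Suc (k v) \<le> 4 * h + 4" by simp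
    moreover have "short_cycle E m (Suc (k v))"
      using short_cycle_one_leaf[OF tree_edge that] aug[OF that] by blast
    ultimately show False using no_cycle short_cycle_mono by blast
  qed
  define b where "b = h + 2"
  define X where "X = {x :: bool list. length x = m - h}"
  have "h \<le> m" using far[of "replicate m True"] aug[of "replicate m True"] by simp
  have X: "card X = 2 ^ (m - h)" "finite X" unfolding X_def by (rule card_words)+

  \<comment> \<open>The pigeonhole principle on scales: two leaves below \<open>x\<close> reach the same large scale.\<close>
  have "\<exists>u u' i. length u = h \<and> length u' = h \<and> i < L \<and> k (u @ x) \<noteq> k (u' @ x) \<and>
      k (u @ x) \<in> {4 * tower b i<..4 * tower b (Suc i)} \<and>
      k (u' @ x) \<in> {4 * tower b i<..4 * tower b (Suc i)}" if "x \<in> X" for x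
  proof -
    let ?s = "\<lambda>u. scale b (k (u @ x))"
    let ?H = "{u :: bool list. length u = h}"
    have leaf: "length (u @ x) = m" if "u \<in> ?H" for u
      using that \<open>x \<in> X\<close> \<open>h \<le> m\<close> by (simp add: X_def)
    have kb: "k (u @ x) \<le> 4 * tower b L" if "u \<in> ?H" for u
      using aug[OF leaf[OF that]] height by (simp add: b_def)
    have "?s ` ?H \<subseteq> {..<4 * b + 1 + L}" using kb scale_less by blast
    then have "card (?s ` ?H) \<le> 4 * b + 1 + L" using card_mono[of "{..<4 * b + 1 + L}"] by simp
    also have "\<dots> < card ?H" using few_scales by (simp add: b_def card_words)
    finally have "\<not> inj_on ?s ?H" by (rule pigeonhole)
    then obtain u u' where u: "u \<in> ?H" "u' \<in> ?H" "u \<noteq> u'" "?s u = ?s u'"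
      by (auto simp: inj_on_def)
    have ne: "k (u @ x) \<noteq> k (u' @ x)"
    proof
      assume eq: "k (u @ x) = k (u' @ x)"
      let ?a = "drop (k (u @ x) - h) x"
      have "drop (k (u @ x)) (u @ x) = ?a" "drop (k (u' @ x)) (u' @ x) = ?a"
        using u far[OF leaf[OF u(1)]] eq by auto
      moreover have "length ?a < length x"
        using far[OF leaf[OF u(1)]] aug[OF leaf[OF u(1)]] \<open>x \<in> X\<close> by (auto simp: X_def)
      ultimately have "short_cycle E m (2 * h + 2)"
        using short_cycle_common_end[OF tree_edge, where u = u and u' = u' and x = x and a = ?a] u leaf
          aug[OF leaf[OF u(1)]] aug[OF leaf[OF u(2)]] by auto
      then show False using no_cycle short_cycle_mono by fastforce
    qed
    then have "4 * b < k (u @ x)" "4 * b < k (u' @ x)"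
      using u scale_small[of b "k (u @ x)" "k (u' @ x)"] scale_small[of b "k (u' @ x)" "k (u @ x)"]
      by (force simp: not_le)+
    then obtain i i' where
      "?s u = 4 * b + 1 + i" "i < L" "4 * tower b i < k (u @ x)" "k (u @ x) \<le> 4 * tower b (Suc i)"
      "?s u' = 4 * b + 1 + i'" "4 * tower b i' < k (u' @ x)" "k (u' @ x) \<le> 4 * tower b (Suc i')"
      using scale_large kb u by metis
    then show ?thesis using u ne by (intro exI[of _ u] exI[of _ u'] exI[of _ i]) auto
  qed
  then obtain u u' i where pair: "\<And>x. x \<in> X \<Longrightarrow> length (u x) = h \<and> length (u' x) = h \<and> i x < L \<and>
      k (u x @ x) \<noteq> k (u' x @ x) \<and>
      k (u x @ x) \<in> {4 * tower b (i x)<..4 * tower b (Suc (i x))} \<and>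
      k (u' x @ x) \<in> {4 * tower b (i x)<..4 * tower b (Suc (i x))}"
    by metis

  \<comment> \<open>Stated as a product to avoid fractions: \<open>m - h\<close> may be smaller than \<open>h\<close> when no vertex
     is assigned to the scale \<open>j\<close>.\<close>
  have few: "card {x \<in> X. i x = j} * 2 ^ h \<le> 2 ^ (m - h)" for j
  proof (cases "{x \<in> X. i x = j} = {}")
    case False
    define B where "B = tower b j"
    define K where "K = {4 * B<..4 * 2 ^ B}"
    have B: "h + 2 \<le> B" unfolding B_def b_def by (rule le_tower_base)
    have leaf: "length (u x @ x) = m" "length (u' x @ x) = m" if "x \<in> X" for x
      using pair[OF that] that \<open>h \<le> m\<close> by (auto simp: X_def)
    have inK: "k (u x @ x) \<in> K" "k (u' x @ x) \<in> K" if "x \<in> X" "i x = j" for x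
      using pair[OF that(1)] that(2) by (auto simp: K_def B_def)
    have "4 * B < m"
    proof -
      obtain x where "x \<in> X" "i x = j" using False by auto
      then show ?thesis using inK(1)[of x] aug[OF leaf(1)[of x]] by (auto simp: K_def)
    qed
    let ?f = "\<lambda>x. (drop (4 * B - h) x, k (u x @ x), k (u' x @ x))"
    \<comment> \<open>The ancestor of \<open>x\<close> at height \<open>4 B\<close> and the heights reached by the two leaves determine the two
       ends of their augmenting edges, hence \<open>x\<close>.\<close>
    have "inj_on ?f {x \<in> X. i x = j}"
    proof (rule inj_onI, rule ccontr)
      fix x y assume "x \<in> {x \<in> X. i x = j}" "y \<in> {x \<in> X. i x = j}"
        and eq: "?f x = ?f y" and "x \<noteq> y"
      then have x: "x \<in> X" "i x = j" and y: "y \<in> X" "i y = j" by blast+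
      from eq have same: "drop (4 * B - h) y = drop (4 * B - h) x"
        "k (u y @ y) = k (u x @ x)" "k (u' y @ y) = k (u' x @ x)"
        by (metis prod.inject)+
      have u: "length (u x) = h" "length (u' x) = h" "length (u y) = h" "length (u' y) = h"
        and ne: "k (u x @ x) \<noteq> k (u' x @ x)"
        using pair[OF x(1)] pair[OF y(1)] by blast+
      have drop_eq: "drop l (w @ z) = drop (l - 4 * B) (drop (4 * B - h) z)"
        if "l \<in> K" "length w = h" for l w and z :: "bool list"
        using that B by (simp add: K_def)
      let ?y = "drop (4 * B - h) x"
      have len_y: "length ?y = m - 4 * B" using x(1) B by (simp add: X_def)
      let ?a = "drop (k (u x @ x) - 4 * B) ?y" and ?b = "drop (k (u' x @ x) - 4 * B) ?y"
      have drops: "drop (k (u x @ x)) (u x @ x) = ?a" "drop (k (u' x @ x)) (u' x @ x) = ?b"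
        "drop (k (u y @ y)) (u y @ y) = ?a" "drop (k (u' y @ y)) (u' y @ y) = ?b"
        unfolding drop_eq[OF inK(1)[OF x] u(1)] drop_eq[OF inK(2)[OF x] u(2)]
          drop_eq[OF inK(1)[OF y] u(3)] drop_eq[OF inK(2)[OF y] u(4)] unfolding same by (rule refl)+
      have range: "4 * B < k (u x @ x)" "4 * B < k (u' x @ x)" "k (u x @ x) \<le> m" "k (u' x @ x) \<le> m"
        using inK[OF x] aug[OF leaf(1)[OF x(1)]] aug[OF leaf(2)[OF x(1)]] by (auto simp: K_def)
      have lab: "length ?a = m - k (u x @ x)" "length ?b = m - k (u' x @ x)"
        using len_y range by simp_all
      then have "length ?a \<noteq> length ?b" using ne range by linarith
      then have "?a \<noteq> ?b" by metis
      moreover have len: "h + length x = m" "length y = length x"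
        using x(1) y(1) \<open>h \<le> m\<close> by (simp_all add: X_def)
      moreover have "length ?a < length x" "length ?b < length x"
        unfolding lab using range B len by linarith+
      moreover have "{u x @ x, ?a} \<in> E" "{u y @ y, ?a} \<in> E" "{u' x @ x, ?b} \<in> E" "{u' y @ y, ?b} \<in> E"
        using aug[OF leaf(1)[OF x(1)]] aug[OF leaf(2)[OF x(1)]]
          aug[OF leaf(1)[OF y(1)]] aug[OF leaf(2)[OF y(1)]] unfolding drops by blast+
      ultimately have "short_cycle E m (4 * h + 4)"
        using short_cycle_two_common_ends[OF tree_edge u(1,2,3,4)] \<open>x \<noteq> y\<close> by blast
      then show False using no_cycle by blast
    qed
    moreover have "?f ` {x \<in> X. i x = j} \<subseteq> {y. length y = m - 4 * B} \<times> {1..4 * 2 ^ B} \<times> {1..4 * 2 ^ B}"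
    proof (rule image_subsetI)
      fix x assume "x \<in> {x \<in> X. i x = j}"
      then have x: "x \<in> X" "i x = j" by blast+
      have "length (drop (4 * B - h) x) = m - 4 * B" using x(1) B by (simp add: X_def)
      moreover have "K \<subseteq> {1..4 * 2 ^ B}" by (auto simp: K_def)
      ultimately show "?f x \<in> {y. length y = m - 4 * B} \<times> {1..4 * 2 ^ B} \<times> {1..4 * 2 ^ B}"
        using inK[OF x] by blast
    qed
    ultimately have "card {x \<in> X. i x = j} \<le>
        card ({y :: bool list. length y = m - 4 * B} \<times> {1..4 * 2 ^ B :: nat} \<times> {1..4 * 2 ^ B :: nat})"
      by (intro card_inj_on_le[of ?f]) (auto simp: card_words)
    also have "\<dots> = 2 ^ (m - 4 * B + (B + 2) + (B + 2))"
      by (simp add: card_cartesian_product card_words power_add)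
    finally have "card {x \<in> X. i x = j} * 2 ^ h \<le> 2 ^ (m - 4 * B + (B + 2) + (B + 2) + h)"
      by (simp add: power_add)
    also have "\<dots> \<le> 2 ^ (m - h)"
      using B \<open>4 * B < m\<close> by (intro power_increasing) auto
    finally show ?thesis .
  next
    case True
    then show ?thesis by (simp only: card.empty)
  qed

  have "X \<subseteq> (\<Union>j<L. {x \<in> X. i x = j})"
  proof
    fix x assume "x \<in> X"
    then have "i x < L" using pair by blast
    with \<open>x \<in> X\<close> show "x \<in> (\<Union>j<L. {x \<in> X. i x = j})" by blast
  qed
  then have "card X \<le> card (\<Union>j<L. {x \<in> X. i x = j})" using X(2) by (intro card_mono) simp_all
  also have "\<dots> \<le> (\<Sum>j<L. card {x \<in> X. i x = j})" by (rule card_UN_le) simp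
  finally have "card X * 2 ^ h \<le> (\<Sum>j<L. card {x \<in> X. i x = j}) * 2 ^ h" by (rule mult_le_mono1)
  also have "\<dots> = (\<Sum>j<L. card {x \<in> X. i x = j} * 2 ^ h)" by (rule sum_distrib_right)
  also have "\<dots> \<le> of_nat (card {..<L}) * 2 ^ (m - h)" using few by (rule sum_bounded_above)
  also have "\<dots> < 2 ^ h * 2 ^ (m - h)" using few_scales by simp
  finally show False unfolding X(1) by (simp add: mult.commute)
qed

lemma girth_bound:
  assumes G: "drg_graph 2 1 g m V E T \<rho>"
    and "m \<le> 4 * tower (h + 2) L" "4 * h + 9 + L < 2 ^ h"
  shows "g \<le> 4 * h + 4"
proof -
  from G have aug: "augmented_tree 1 V E T \<rho>" and "complete_dary_tree 2 m V T \<rho>"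
    and g: "enat g \<le> girth E" by (simp_all add: drg_graph_def)
  obtain \<phi> :: "bool list \<Rightarrow> 'a" where inj: "inj_on \<phi> {bs. length bs \<le> m}"
    and edge: "\<And>bs b. length bs < m \<Longrightarrow> {\<phi> bs, \<phi> (b # bs)} \<in> T"
    and leaf: "\<And>bs. length bs = m \<Longrightarrow> \<phi> bs \<in> leaves V T \<rho>"
    and anc: "\<And>bs u. length bs \<le> m \<Longrightarrow> ancestor V T \<rho> u (\<phi> bs) \<Longrightarrow>
       \<exists>k. 0 < k \<and> k \<le> length bs \<and> u = \<phi> (drop k bs)"
    and par: "\<And>bs b. length bs < m \<Longrightarrow> parent V T \<rho> (\<phi> bs) (\<phi> (b # bs))"
    using binary_coordinates[OF \<open>complete_dary_tree 2 m V T \<rho>\<close>] by blast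
  obtain A where A: "\<And>v. v \<in> leaves V T \<rho> \<Longrightarrow>
      A v \<subseteq> {u \<in> V. ancestor V T \<rho> u v \<and> \<not> parent V T \<rho> u v} \<and> card (A v) = 1"
    and E: "E = T \<union> {{v, u} | v u. v \<in> leaves V T \<rho> \<and> u \<in> A v}"
    using aug unfolding augmented_tree_def by blast
  have "\<exists>k. 2 \<le> k \<and> k \<le> m \<and> {\<phi> v, \<phi> (drop k v)} \<in> E" if v: "length v = m" for v
  proof -
    obtain a where a: "a \<in> A (\<phi> v)" using A[OF leaf[OF v]] by (metis card_1_singletonE insertI1)
    then have a_anc: "ancestor V T \<rho> a (\<phi> v)" "\<not> parent V T \<rho> a (\<phi> v)" using A[OF leaf[OF v]] by auto
    then obtain k where k: "0 < k" "k \<le> m" "a = \<phi> (drop k v)" using anc[of v a] v by auto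
    \<comment> \<open>Height \<open>1\<close> is that of the parent, to which no augmenting edge goes.\<close>
    have "k \<noteq> 1"
    proof
      assume "k = 1"
      then obtain b bs where "v = b # bs" using k v by (cases v) auto
      then show False using a_anc par[of bs b] k \<open>k = 1\<close> v by auto
    qed
    moreover have "{\<phi> v, a} \<in> E" using E leaf[OF v] a by blast
    ultimately show ?thesis using k by (intro exI[of _ k]) auto
  qed
  then obtain k where k: "\<And>v. length v = m \<Longrightarrow> 2 \<le> k v \<and> k v \<le> m \<and> {\<phi> v, \<phi> (drop (k v) v)} \<in> E"
    by metis
  have "short_cycle {e. \<phi> ` e \<in> E} m (4 * h + 4)"
    by (rule short_cycle_exists[of m _ k h L]) (use edge E k assms in auto)
  then obtain c where c: "is_cycle {e. \<phi> ` e \<in> E} c" "length c \<le> 4 * h + 4" "\<forall>x\<in>set c. length x \<le> m"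
    unfolding short_cycle_def by blast
  have "inj_on \<phi> (set c)" using inj c(3) by (rule_tac inj_on_subset) auto
  then have "is_cycle E (map \<phi> c)" using is_cycle_map c(1) by blast
  then have "girth E \<le> enat (length (map \<phi> c))" unfolding girth_def by (intro INF_lower) simp
  with g have "enat g \<le> enat (length (map \<phi> c))" by (rule order_trans)
  then show ?thesis using c(2) by simp
qed

section \<open>The iterated logarithm\<close>

lemma le_tower_if_iterated_log_le:
  "(log 2 ^^ n) x \<le> real b \<Longrightarrow> x \<le> real (tower b n)"
proof (induction n arbitrary: x)
  case (Suc n)
  then have le: "log 2 x \<le> real (tower b n)" by (simp add: funpow_Suc_right del: funpow.simps)
  show ?case
  proof (cases "x > 0")
    case True
    then have "x \<le> 2 powr real (tower b n)" using le by (simp add: log_le_iff)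
    then show ?thesis by (simp add: powr_realpow)
  next
    case False
    \<comment> \<open>Here \<open>log 2 x\<close> is not a meaningful logarithm, but \<open>x\<close> is at most \<open>0\<close>.\<close>
    then show ?thesis by (simp add: order_trans[of x 0])
  qed
qed simp

lemma iterated_log_le_if_le_tower:
  "x \<le> real (tower 1 n) \<Longrightarrow> \<exists>k. (log 2 ^^ k) x \<le> 1"
proof (induction n arbitrary: x)
  case 0
  then show ?case by (intro exI[of _ 0]) simp
next
  case (Suc n)
  show ?case
  proof (cases "x \<le> 1")
    case True
    then show ?thesis by (intro exI[of _ 0]) simp
  next
    case False
    then have "log 2 x \<le> real (tower 1 n)" using Suc.prems by (simp add: log_le_iff powr_realpow)
    then obtain k where "(log 2 ^^ k) (log 2 x) \<le> 1" using Suc.IH by blast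
    then show ?thesis by (intro exI[of _ "Suc k"]) (simp add: funpow_Suc_right del: funpow.simps)
  qed
qed

text \<open>Starting the tower at some \<open>b \<ge> 1\<close> instead of \<open>1\<close> only makes it grow faster, so \<open>log\<^sup>* m\<close> large
  scales always suffice.\<close>

lemma le_tower_log_star:
  assumes "1 \<le> b"
  shows "m \<le> tower b (log_star (real m))"
proof -
  have "\<exists>k. (log 2 ^^ k) (real m) \<le> 1"
    using iterated_log_le_if_le_tower[of "real m" m] le_tower_index[of m 1] by simp
  then have "(log 2 ^^ log_star (real m)) (real m) \<le> 1" unfolding log_star_def by (rule LeastI_ex)
  then show ?thesis using le_tower_if_iterated_log_le[of _ "real m" b] assms by force
qed

lemma log_star_unbounded: "tower 1 n < m \<Longrightarrow> n < log_star (real m)"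
  using le_tower_log_star[of 1 m] tower_mono[of "log_star (real m)" n 1] by linarith

theorem theorem4p1:
  fixes \<epsilon> :: real
  assumes "\<epsilon> > 0"
  shows "\<exists>M. \<forall>m\<ge>M. \<forall>g::nat.
    (\<exists>(V :: 'a set) E T \<rho>. drg_graph 2 1 g m V E T \<rho>) \<longrightarrow>
      real g \<le> (4 + \<epsilon>) * log 2 (real (log_star (real m)))"
proof -
  \<comment> \<open>Let \<open>L = log\<^sup>* m\<close>.  With \<open>h\<close> at most \<open>log L + 2\<close>, the bound \<open>4 h + 4\<close> on the girth exceeds \<open>4 log L\<close> by at
     most \<open>12\<close>, which \<open>\<epsilon> log L\<close> absorbs for \<open>log L \<ge> 12 / \<epsilon>\<close>.  The bound \<open>7\<close> gives \<open>h \<ge> 8\<close>, hence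
     \<open>4 h + 9 < 2 ^ (h - 2) \<le> L\<close>.\<close>
  define n where "n = nat \<lceil>max 7 (12 / \<epsilon>)\<rceil>"
  have n: "7 \<le> n" "12 \<le> \<epsilon> * real n"
  proof -
    have "max 7 (12 / \<epsilon>) \<le> real n" unfolding n_def by linarith
    then show "7 \<le> n" "12 \<le> \<epsilon> * real n" using \<open>\<epsilon> > 0\<close> by (simp_all add: field_simps)
  qed
  show ?thesis
  proof (intro exI[of _ "Suc (tower 1 (2 ^ n))"] allI impI)
    fix m g assume "Suc (tower 1 (2 ^ n)) \<le> m"
      and "\<exists>(V :: 'a set) E T \<rho>. drg_graph 2 1 g m V E T \<rho>"
    then obtain V :: "'a set" and E T \<rho> where G: "drg_graph 2 1 g m V E T \<rho>" by blast
    define L where "L = log_star (real m)"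
    have "2 ^ n \<le> L"
      using log_star_unbounded[of "2 ^ n" m] \<open>Suc (tower 1 (2 ^ n)) \<le> m\<close> by (simp add: L_def)
    then have "(2::real) ^ n \<le> real L" by (metis of_nat_le_iff of_nat_numeral of_nat_power)
    moreover from this have L: "0 < real L" by (meson less_le_trans zero_less_numeral zero_less_power)
    ultimately have log: "real n \<le> log 2 (real L)" by (simp add: le_log_iff powr_realpow)
    define h where "h = nat \<lceil>log 2 (real L)\<rceil> + 1"
    have h: "log 2 (real L) + 1 \<le> real h" "real h \<le> log 2 (real L) + 2"
      unfolding h_def using log by linarith+
    have "2 * real L = 2 powr (log 2 (real L) + 1)" using L by (simp add: powr_add)
    also have "\<dots> \<le> 2 powr real h" using h(1) by simp
    finally have "real (2 * L) \<le> real (2 ^ h)" by (simp add: powr_realpow)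
    then have "2 * L \<le> 2 ^ h" by (simp only: of_nat_le_iff)
    moreover have "4 * h + 9 < L"
    proof -
      have "8 \<le> h" using h(1) log n(1) by linarith
      then have "4 * h + 9 < 2 ^ (h - 2)"
      proof (induction h rule: nat_induct_at_least)
        case (Suc h)
        then have "(2::nat) ^ (Suc h - 2) = 2 * 2 ^ (h - 2)" by (simp add: Suc_diff_le flip: power_Suc)
        then show ?case using Suc by simp
      qed simp
      also have "2 ^ (h - 2) \<le> L"
      proof -
        have "2 powr real (h - 2) \<le> 2 powr log 2 (real L)" using h(2) \<open>8 \<le> h\<close> by simp
        then have "real (2 ^ (h - 2)) \<le> real L" using L by (simp add: powr_realpow)
        then show ?thesis by (simp only: of_nat_le_iff)
      qed
      finally show ?thesis .
    qed
    ultimately have "4 * h + 9 + L < 2 ^ h" by linarith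
    moreover have "m \<le> 4 * tower (h + 2) L" using le_tower_log_star[of "h + 2" m] by (simp add: L_def)
    ultimately have "g \<le> 4 * h + 4" using girth_bound[OF G] by blast
    then have "real g \<le> 4 * log 2 (real L) + 12" using h(2) by linarith
    also have "12 \<le> \<epsilon> * log 2 (real L)"
      using n(2) mult_left_mono[OF log, of \<epsilon>] \<open>\<epsilon> > 0\<close> by linarith
    also have "4 * log 2 (real L) + \<epsilon> * log 2 (real L) = (4 + \<epsilon>) * log 2 (real L)"
      by (simp add: algebra_simps)
    finally show "real g \<le> (4 + \<epsilon>) * log 2 (real (log_star (real m)))" by (simp add: L_def)
  qed
qed

end
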